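(* Let $N\ge3$ be odd and let $z=(z_1,\dots,z_{2N})$ be non-zero complex segment variables assigned to the diagram of the torus knot $T(2,N)$ described in the context, such that two segments adjacent at a corner of a crossing have distinct variables. Then $z$ is a boundary parabolic solution if and only if there are complex numbers $p,q,r,\Lambda$ such that $$z_{2i-1}=\frac{pq\sqrt\Lambda\,B_{i-1}+p(r-q)B_i}{(r-q)B_{i-2}+p\sqrt\Lambda\,B_{i-1}},\qquad z_{2i}=\frac{pq\sqrt\Lambda\,B_{i-2}+p(r-q)B_{i-1}}{(r-q)B_{i-1}+p\sqrt\Lambda\,B_i}\qquad(1\le i\le N)$$ (with non-zero denominators), where $(B_i)_{i\in\mathbb Z}$ is the base $\sqrt\Lambda$-Fibonacci sequence and $\Lambda$ satisfies $B_N=0$.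
   Context: **Fibonacci sequences.** For $W\in\mathbb C$, the base $W$-Fibonacci sequence $(B_i)_{i\in\mathbb Z}$ is defined by $B_0=0$, $B_1=1$, $B_{i+1}=WB_i+B_{i-1}$ for all $i\in\mathbb Z$. Here $\sqrt\Lambda$ is a fixed square root of $\Lambda$; the formulas above depend only on $\Lambda$. **Diagram of $T(2,N)$.** A horizontal row of $N$ crossings numbered $1,\dots,N$ from left to right. The $i$-th crossing has upper-left segment $z_{2i-1}$, lower-left segment $z_{2i}$, upper-right segment $z_{2i+1}$, lower-right segment $z_{2i+2}$; the strand joining upper-left to lower-right passes over, the strand joining lower-left to upper-right passes under. The row is closed up by an arc above it making $z_{2N+1}$ and $z_1$ the same segment, and an arc below it making $z_{2N+2}$ and $z_2$ the same segment. (Segments are denoted by their variables.) The orientation runs from left to right through the row. **Boundary parabolic solution.** Left/right is with respect to the direction of travel along the oriented diagram, seen from above. For a segment with variable $z_c$ starting at a crossing $X$ and ending at a crossing $Y$, let $z_a,z_b$ be the variables of the two segments of the other strand at $X$ lying to its left and right, and $z_d,z_e$ those of the two segments of the other strand at $Y$ lying to its left and right. The hyperbolicity equation of the segment is: (a) over at $X$, under at $Y$: $\frac{z_c-z_a}{z_c-z_b}\cdot\frac{z_d(z_c-z_e)}{z_e(z_c-z_d)}=1$; (b) under at $X$, over at $Y$: $\frac{z_a(z_c-z_b)}{z_b(z_c-z_a)}\cdot\frac{z_c-z_d}{z_c-z_e}=1$; (c) over at both: $\frac{z_c-z_a}{z_c-z_b}\cdot\frac{z_c-z_e}{z_c-z_d}=1$;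 (d) under at both: $\frac{z_a(z_c-z_b)}{z_b(z_c-z_a)}\cdot\frac{z_e(z_c-z_d)}{z_d(z_c-z_e)}=1$. A boundary parabolic solution is a tuple of non-zero segment variables satisfying the hyperbolicity equation of every segment and such that two segments adjacent at a corner of a crossing (consecutive in the cyclic order around it) have distinct variables. *)

theory Defs
  imports Complex_Main
begin

function fibW :: "complex \<Rightarrow> int \<Rightarrow> complex" where
  "fibW W i =
    (if i = 0 then 0
     else if i = 1 then 1
     else if i > 1 then W * fibW W (i - 1) + fibW W (i - 2)
     else fibW W (i + 2) - W * fibW W (i + 1))"
  by pat_completeness auto
termination
  by (relation "measure (\<lambda>(W, i). nat \<bar>2 * i - 1\<bar>)") auto

declare fibW.simps [simp del]

lemma fibW_0 [simp]: "fibW W 0 = 0"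
  by (simp add: fibW.simps)

lemma fibW_1 [simp]: "fibW W 1 = 1"
  by (simp add: fibW.simps)

text \<open>The three defining conditions of the base \<open>W\<close>-Fibonacci sequence, which determine it.\<close>

lemma fibW_rec: "fibW W (i + 1) = W * fibW W i + fibW W (i - 1)"
proof (cases "i \<ge> 1")
  case True
  then show ?thesis by (subst fibW.simps) simp
next
  case False
  then have "fibW W (i - 1) = fibW W (i + 1) - W * fibW W i"
    by (subst fibW.simps) (simp add: add.commute)
  then show ?thesis by simp
qed

lemma fibW_unique:
  assumes "B 0 = 0" "B 1 = 1" "\<And>i::int. B (i + 1) = W * B i + B (i - 1)"
  shows "B = fibW W"
proof
  fix i
  have "B i = fibW W i \<and> B (i + 1) = fibW W (i + 1)"
  proof (induction i rule: int_induct[where k = 0])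
    case base
    show ?case using assms(1,2) by simp
  next
    case (step1 i)
    then show ?case
      using assms(3)[of "i + 1"] fibW_rec[of W "i + 1"] by simp
  next
    case (step2 i)
    then show ?case
      using assms(3)[of i] fibW_rec[of W i] by auto
  qed
  then show "B i = fibW W i" ..
qed

text \<open>
  Every oriented crossing, rotated suitably, has both of its strands running from left to right:
  the falling strand from the upper-left to the lower-right segment, and the rising strand from
  the lower-left to the upper-right segment.
\<close>

datatype strand = Falling | Rising

record 's crossing =
  upper_left :: 's
  lower_left :: 's
  upper_right :: 's
  lower_right :: 's
  over_strand :: strand

type_synonym 's diagram = "'s crossing set"

fun incoming :: "'s crossing \<Rightarrow> strand \<Rightarrow> 's" where
  "incoming X Falling = upper_left X"
| "incoming X Rising = lower_left X"

fun outgoing :: "'s crossing \<Rightarrow> strand \<Rightarrow> 's" where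
  "outgoing X Falling = lower_right X"
| "outgoing X Rising = upper_right X"

text \<open>
  The segments of the other strand lying to the left and to the right of a traveller along the
  given strand; they are the same for its incoming and its outgoing segment.
\<close>

fun left_of :: "'s crossing \<Rightarrow> strand \<Rightarrow> 's" where
  "left_of X Falling = upper_right X"
| "left_of X Rising = upper_left X"

fun right_of :: "'s crossing \<Rightarrow> strand \<Rightarrow> 's" where
  "right_of X Falling = lower_left X"
| "right_of X Rising = lower_right X"

definition segments :: "'s diagram \<Rightarrow> 's set" where
  "segments D = (\<Union>X\<in>D. {upper_left X, lower_left X, upper_right X, lower_right X})"

definition corners_distinct :: "'s diagram \<Rightarrow> ('s \<Rightarrow> complex) \<Rightarrow> bool" where
  "corners_distinct D z \<longleftrightarrow>
    (\<forall>X\<in>D. z (upper_left X) \<noteq> z (upper_right X) \<and>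
           z (upper_right X) \<noteq> z (lower_right X) \<and>
           z (lower_right X) \<noteq> z (lower_left X) \<and>
           z (lower_left X) \<noteq> z (upper_left X))"

text \<open>
  The hyperbolicity equation of a segment with variable \<open>c\<close>; the first two arguments say whether
  the segment passes over at its starting crossing and at its ending crossing, \<open>a\<close>, \<open>b\<close> are the
  left and right variables at the start, and \<open>d\<close>, \<open>e\<close> those at the end.
\<close>

fun hyperbolicity_eq ::
  "bool \<Rightarrow> bool \<Rightarrow> complex \<Rightarrow> complex \<Rightarrow> complex \<Rightarrow> complex \<Rightarrow> complex \<Rightarrow> bool" where
  "hyperbolicity_eq True False c a b d e \<longleftrightarrow>
     (c - a) / (c - b) * ((d * (c - e)) / (e * (c - d))) = 1"
| "hyperbolicity_eq False True c a b d e \<longleftrightarrow>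
     (a * (c - b)) / (b * (c - a)) * ((c - d) / (c - e)) = 1"
| "hyperbolicity_eq True True c a b d e \<longleftrightarrow>
     (c - a) / (c - b) * ((c - e) / (c - d)) = 1"
| "hyperbolicity_eq False False c a b d e \<longleftrightarrow>
     (a * (c - b)) / (b * (c - a)) * ((e * (c - d)) / (d * (c - e))) = 1"

text \<open>
  A segment from \<open>X\<close> to \<open>Y\<close> is an outgoing segment of a strand \<open>s\<close> at \<open>X\<close> that is an incoming
  segment of a strand \<open>t\<close> at \<open>Y\<close>.
\<close>

definition hyperbolicity_eqs :: "'s diagram \<Rightarrow> ('s \<Rightarrow> complex) \<Rightarrow> bool" where
  "hyperbolicity_eqs D z \<longleftrightarrow>
    (\<forall>X\<in>D. \<forall>Y\<in>D. \<forall>s t. outgoing X s = incoming Y t \<longrightarrow>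
      hyperbolicity_eq (s = over_strand X) (t = over_strand Y) (z (outgoing X s))
        (z (left_of X s)) (z (right_of X s)) (z (left_of Y t)) (z (right_of Y t)))"

definition boundary_parabolic_solution :: "'s diagram \<Rightarrow> ('s \<Rightarrow> complex) \<Rightarrow> bool" where
  "boundary_parabolic_solution D z \<longleftrightarrow>
    (\<forall>k\<in>segments D. z k \<noteq> 0) \<and> corners_distinct D z \<and> hyperbolicity_eqs D z"

text \<open>
  The diagram of \<open>T(2,N)\<close> has the segments \<open>1, \<dots>, 2 * N\<close>; the closing arcs identify the labels
  \<open>2 * N + 1\<close> and \<open>2 * N + 2\<close> with \<open>1\<close> and \<open>2\<close>.
\<close>

definition torus_segment :: "nat \<Rightarrow> nat \<Rightarrow> nat" where
  "torus_segment N k = (if k > 2 * N then k - 2 * N else k)"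

definition torus_crossing :: "nat \<Rightarrow> nat \<Rightarrow> nat crossing" where
  "torus_crossing N i =
    \<lparr> upper_left = torus_segment N (2 * i - 1),
      lower_left = torus_segment N (2 * i),
      upper_right = torus_segment N (2 * i + 1),
      lower_right = torus_segment N (2 * i + 2),
      over_strand = Falling \<rparr>"

definition torus_diagram :: "nat \<Rightarrow> nat diagram" where
  "torus_diagram N = torus_crossing N ` {1..N}"

lemma segments_torus_diagram:
  assumes "N \<ge> 1"
  shows "segments (torus_diagram N) = {1..2 * N}"
proof
  show "segments (torus_diagram N) \<subseteq> {1..2 * N}"
    using assms
    by (auto simp: segments_def torus_diagram_def torus_crossing_def torus_segment_def)
  show "{1..2 * N} \<subseteq> segments (torus_diagram N)"
  proof
    fix k assume k: "k \<in> {1..2 * N}"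
    define i where "i = (k + 1) div 2"
    have i: "i \<in> {1..N}" using k by (auto simp: i_def)
    have "k = 2 * i - 1 \<or> k = 2 * i" by (auto simp: i_def)
    then have "k = upper_left (torus_crossing N i) \<or> k = lower_left (torus_crossing N i)"
      using k by (auto simp: torus_crossing_def torus_segment_def)
    then show "k \<in> segments (torus_diagram N)"
      using i by (force simp: segments_def torus_diagram_def)
  qed
qed

end

theory Submission
  imports Defs
begin

text \<open>
  Write \<open>x i\<close>, \<open>y i\<close> for the upper and lower variables left of the \<open>i\<close>-th crossing, \<open>i\<close> taken
  modulo \<open>N\<close>. Two factors cancel in every hyperbolicity equation, leaving
  \<open>x i * (y i - y (i + 1)) = y (i + 1) * (y i - y (i - 1))\<close> and
  \<open>x (i - 1) * (x i - x (i + 1)) = y i * (x i - x (i - 1))\<close>. If \<open>X\<close> and \<open>D\<close> satisfy the recurrence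
  of the base \<open>s\<close>-Fibonacci sequence, then \<open>x i = X i / D i\<close>, \<open>y i = X (i - 1) / D (i + 1)\<close> solve
  these relations; the stated formulas are of this shape, with \<open>p = x 1\<close>, \<open>q = y 1\<close>, \<open>r = x 2\<close>, and
  \<open>s\<^sup>2\<close> read off from \<open>y 2\<close>. The relations determine \<open>x\<close> and \<open>y\<close> from four consecutive values, so
  every solution arises this way unless \<open>x 2 = y 1\<close> or \<open>x 1 = y 2\<close>. These exceptions force \<open>x\<close> to
  have period 2, which is impossible for odd \<open>N\<close>. Finally
  \<open>X (N + 1) * D 1 - X 1 * D (N + 1)\<close> is a non-zero multiple of \<open>B N\<close>, so closing up amounts to
  \<open>B N = 0\<close>.
\<close>

section \<open>Fibonacci recurrences\<close>

definition fib_rec :: "complex \<Rightarrow> (int \<Rightarrow> complex) \<Rightarrow> bool" where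
  "fib_rec s V \<longleftrightarrow> (\<forall>i. V (i + 1) = s * V i + V (i - 1))"

lemma fib_recD: "fib_rec s V \<Longrightarrow> V (i + 1) = s * V i + V (i - 1)"
  by (simp add: fib_rec_def)

lemma fib_rec_fibW_shift: "fib_rec s (\<lambda>i. fibW s (i + k))"
  using fibW_rec[of s "_ + k"] by (simp add: fib_rec_def algebra_simps)

lemma fib_rec_combination:
  assumes "fib_rec s V" "fib_rec s W"
  shows "fib_rec s (\<lambda>i. a * V i + b * W i)"
  using assms by (simp add: fib_rec_def algebra_simps)

lemma fibW_minus_1 [simp]: "fibW s (- 1) = 1"
  using fibW_rec[of s 0] by simp

lemma fibW_2 [simp]: "fibW s 2 = s"
  using fibW_rec[of s 1] by simp

text \<open>Both sides, as functions of \<open>k\<close>, satisfy the recurrence and agree at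
  \<open>k = 0\<close> and \<open>k = 1\<close>; the induction runs in both directions from
  there.\<close>

lemma fib_rec_addition:
  assumes "fib_rec s V"
  shows "V (m + k) = V m * fibW s (k - 1) + V (m + 1) * fibW s k"
proof -
  let ?R = "\<lambda>k. V m * fibW s (k - 1) + V (m + 1) * fibW s k"
  have V: "fib_rec s (\<lambda>k. V (m + k))"
    using fib_recD[OF assms, of "m + _"] by (simp add: fib_rec_def algebra_simps)
  have R: "fib_rec s ?R"
    using fib_rec_combination[OF fib_rec_fibW_shift[of s "-1"] fib_rec_fibW_shift[of s 0]] by simp
  have "V (m + k) = ?R k \<and> V (m + (k + 1)) = ?R (k + 1)"
  proof (induction k rule: int_induct[where k = 0])
    case base
    show ?case by simp
  next
    case (step1 k)
    then show ?case
      using fib_recD[OF V, of "k + 1"] fib_recD[OF R, of "k + 1"] by simp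
  next
    case (step2 k)
    then show ?case
      using fib_recD[OF V, of k] fib_recD[OF R, of k] by auto
  qed
  then show ?thesis ..
qed

text \<open>The factor is the same for every solution \<open>V\<close>, so a zero of
  \<open>fibW s\<close> at \<open>n\<close> makes quotients of two solutions
  \<open>n\<close>-periodic.\<close>

lemma fib_rec_shift_period:
  assumes "fib_rec s V" "fibW s n = 0"
  shows "V (i + n) = fibW s (n + 1) * V i"
proof -
  have "fibW s (n + 1) = fibW s (n - 1)"
    using fibW_rec[of s n] assms(2) by simp
  then show ?thesis
    using fib_rec_addition[OF assms(1), of i n] assms(2) by simp
qed

lemma fibW_Suc_nonzero:
  assumes "fibW s n = 0"
  shows "fibW s (n + 1) \<noteq> 0"
  \<comment> \<open>Shifting \<open>1 - n\<close> to \<open>1\<close> exhibits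
    \<open>fibW s 1 = 1\<close> as a multiple of \<open>fibW s (n + 1)\<close>.\<close>
  using fib_rec_shift_period[OF fib_rec_fibW_shift[of s 0] assms, of "1 - n"] by auto

section \<open>The hyperbolicity equations of the torus diagram\<close>

definition torus_relations :: "(int \<Rightarrow> complex) \<Rightarrow> (int \<Rightarrow> complex) \<Rightarrow> bool" where
  "torus_relations x y \<longleftrightarrow>
    (\<forall>i. x i * (y i - y (i + 1)) = y (i + 1) * (y i - y (i - 1)) \<and>
         x (i - 1) * (x i - x (i + 1)) = y i * (x i - x (i - 1)))"

text \<open>Crossings are numbered from 1, hence the residue of \<open>i - 1\<close>. Integer
  indices modulo \<open>N\<close> remove the ends of the row, so the closing arcs need no separate
  treatment later.\<close>

definition upper :: "nat \<Rightarrow> int \<Rightarrow> nat" where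
  "upper N i = 2 * nat ((i - 1) mod int N) + 1"

definition lower :: "nat \<Rightarrow> int \<Rightarrow> nat" where
  "lower N i = 2 * nat ((i - 1) mod int N) + 2"

definition cyclic_crossing :: "nat \<Rightarrow> int \<Rightarrow> nat crossing" where
  "cyclic_crossing N i = torus_crossing N (nat ((i - 1) mod int N) + 1)"

lemma upper_add_period [simp]: "upper N (i + int N) = upper N i"
  by (simp add: upper_def diff_add_eq[symmetric])

lemma lower_add_period [simp]: "lower N (i + int N) = lower N i"
  by (simp add: lower_def diff_add_eq[symmetric])

lemma upper_of_nat: "i \<in> {1..N} \<Longrightarrow> upper N (int i) = 2 * i - 1"
  by (auto simp: upper_def)

lemma lower_of_nat: "i \<in> {1..N} \<Longrightarrow> lower N (int i) = 2 * i"
  by (auto simp: lower_def)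

context
  fixes N :: nat
  assumes N: "N \<ge> 1"
begin

lemma torus_diagram_cyclic: "torus_diagram N = range (cyclic_crossing N)"
proof -
  have range: "range (\<lambda>i. nat ((i - 1) mod int N) + 1) = {1..N}"
  proof (intro equalityI subsetI)
    fix k assume "k \<in> {1..N}"
    then have "k = nat ((int k - 1) mod int N) + 1" by auto
    then show "k \<in> range (\<lambda>i. nat ((i - 1) mod int N) + 1)" by blast
  next
    fix k assume "k \<in> range (\<lambda>i. nat ((i - 1) mod int N) + 1)"
    then obtain i where k: "k = nat ((i - 1) mod int N) + 1" by blast
    have "(i - 1) mod int N < int N" "0 \<le> (i - 1) mod int N" using N by auto
    then show "k \<in> {1..N}" using k by auto
  qed
  show ?thesis
    unfolding torus_diagram_def cyclic_crossing_def[abs_def] range[symmetric] image_image ..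
qed

lemma segment_bounds: "upper N i \<in> {1..2 * N}" "lower N i \<in> {1..2 * N}"
proof -
  have "(i - 1) mod int N < int N" "0 \<le> (i - 1) mod int N" using N by auto
  then show "upper N i \<in> {1..2 * N}" "lower N i \<in> {1..2 * N}"
    by (auto simp: upper_def lower_def)
qed

lemma cyclic_crossing_simps [simp]:
  "upper_left (cyclic_crossing N i) = upper N i"
  "lower_left (cyclic_crossing N i) = lower N i"
  "upper_right (cyclic_crossing N i) = upper N (i + 1)"
  "lower_right (cyclic_crossing N i) = lower N (i + 1)"
  "over_strand (cyclic_crossing N i) = Falling"
proof -
  define m where "m = (i - 1) mod int N"
  have m: "0 \<le> m" "m < int N" using N by (auto simp: m_def)
  have "i mod int N = (m + 1) mod int N"
    by (simp add: m_def mod_simps)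
  also have "\<dots> = (if m + 1 = int N then 0 else m + 1)"
    using m by auto
  \<comment> \<open>The first case is the last crossing, where \<open>torus_segment\<close> sends
    the right-hand labels back to 1 and 2.\<close>
  finally have i: "i mod int N = (if m + 1 = int N then 0 else m + 1)" .
  show "upper_left (cyclic_crossing N i) = upper N i"
    "lower_left (cyclic_crossing N i) = lower N i"
    "upper_right (cyclic_crossing N i) = upper N (i + 1)"
    "lower_right (cyclic_crossing N i) = lower N (i + 1)"
    "over_strand (cyclic_crossing N i) = Falling"
    using m i
    by (auto simp: cyclic_crossing_def torus_crossing_def torus_segment_def upper_def lower_def
        simp flip: m_def)
qed

lemma upper_neq_lower: "upper N i \<noteq> lower N j" "lower N j \<noteq> upper N i"
proof -
  have "odd (upper N i)" "even (lower N j)" by (auto simp: upper_def lower_def)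
  then show "upper N i \<noteq> lower N j" "lower N j \<noteq> upper N i" by metis+
qed

lemma upper_eq_imp_crossing_eq:
  "upper N i = upper N j \<Longrightarrow> cyclic_crossing N i = cyclic_crossing N j"
  by (simp add: upper_def cyclic_crossing_def)

lemma lower_eq_imp_crossing_eq:
  "lower N i = lower N j \<Longrightarrow> cyclic_crossing N i = cyclic_crossing N j"
  by (simp add: lower_def cyclic_crossing_def)

text \<open>A lower segment leaves one crossing on the falling strand and enters the next on the
  rising one; an upper segment does the reverse. As the falling strand is always over, only the
  over-under and under-over equations occur.\<close>

lemma hyperbolicity_eqs_torus:
  "hyperbolicity_eqs (torus_diagram N) z \<longleftrightarrow>
    (\<forall>i. hyperbolicity_eq True False (z (lower N i)) (z (upper N i)) (z (lower N (i - 1)))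
            (z (upper N i)) (z (lower N (i + 1))) \<and>
         hyperbolicity_eq False True (z (upper N i)) (z (upper N (i - 1))) (z (lower N i))
            (z (upper N (i + 1))) (z (lower N i)))"
    (is "?L \<longleftrightarrow> (\<forall>i. ?a i \<and> ?b i)")
proof
  assume L: ?L
  show "\<forall>i. ?a i \<and> ?b i"
  proof
    fix i
    show "?a i \<and> ?b i"
      using L[unfolded hyperbolicity_eqs_def torus_diagram_cyclic, rule_format,
          of "cyclic_crossing N (i - 1)" "cyclic_crossing N i" Falling Rising]
        L[unfolded hyperbolicity_eqs_def torus_diagram_cyclic, rule_format,
          of "cyclic_crossing N (i - 1)" "cyclic_crossing N i" Rising Falling]
      by simp
  qed
next
  assume R: "\<forall>i. ?a i \<and> ?b i"
  show ?L
    unfolding hyperbolicity_eqs_def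
  proof (intro ballI allI impI)
    fix X Y s t
    assume "X \<in> torus_diagram N" "Y \<in> torus_diagram N" and eq: "outgoing X s = incoming Y t"
    then obtain j k where X: "X = cyclic_crossing N j" and Y: "Y = cyclic_crossing N k"
      unfolding torus_diagram_cyclic by blast
    \<comment> \<open>Parity of the labels rules out \<open>s = t\<close>; equal labels of the same
      parity have the same residue and hence the same crossing.\<close>
    have "Y = cyclic_crossing N (j + 1) \<and> (s = Falling \<longleftrightarrow> t = Rising)"
      using eq upper_eq_imp_crossing_eq[of "j + 1" k] lower_eq_imp_crossing_eq[of "j + 1" k]
      unfolding X Y by (cases s; cases t) (simp_all add: upper_neq_lower)
    then show "hyperbolicity_eq (s = over_strand X) (t = over_strand Y) (z (outgoing X s))
        (z (left_of X s)) (z (right_of X s)) (z (left_of Y t)) (z (right_of Y t))"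
      using R[rule_format, of "j + 1"] unfolding X by (cases s; cases t) (simp_all add: add.assoc)
  qed
qed

text \<open>A lower segment has the same left neighbour at both ends, an upper segment the same
  right neighbour, and these factors cancel. Distinct corners and non-zero variables allow the
  remaining denominators to be cleared.\<close>

lemma hyperbolicity_eqs_torus_iff:
  assumes nz: "\<forall>k\<in>{1..2 * N}. z k \<noteq> 0" and distinct: "corners_distinct (torus_diagram N) z"
  shows "hyperbolicity_eqs (torus_diagram N) z \<longleftrightarrow>
    torus_relations (\<lambda>i. z (upper N i)) (\<lambda>i. z (lower N i))"
  unfolding hyperbolicity_eqs_torus torus_relations_def
proof (rule all_cong1, rule conj_cong)
  fix i
  define x where "x = (\<lambda>i. z (upper N i))"
  define y where "y = (\<lambda>i. z (lower N i))"
  have nz: "x i \<noteq> 0" "y i \<noteq> 0" for i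
    using nz segment_bounds by (auto simp: x_def y_def)
  have "x i \<noteq> x (i + 1)" "x (i + 1) \<noteq> y (i + 1)" "y (i + 1) \<noteq> y i" for i
    using distinct by (auto simp: corners_distinct_def torus_diagram_cyclic x_def y_def)
  from this[of "i - 1"] have d: "x (i - 1) \<noteq> x i" "x i \<noteq> y i" "y i \<noteq> y (i - 1)"
    by simp_all
  have "hyperbolicity_eq True False (y i) (x i) (y (i - 1)) (x i) (y (i + 1)) \<longleftrightarrow>
      x i * (y i - y (i + 1)) = y (i + 1) * (y i - y (i - 1))"
    using d nz[of "i + 1"] by (auto simp: divide_simps)
  then show "hyperbolicity_eq True False (z (lower N i)) (z (upper N i)) (z (lower N (i - 1)))
      (z (upper N i)) (z (lower N (i + 1))) \<longleftrightarrow>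
      z (upper N i) * (z (lower N i) - z (lower N (i + 1))) =
      z (lower N (i + 1)) * (z (lower N i) - z (lower N (i - 1)))"
    by (simp add: x_def y_def)
  have "hyperbolicity_eq False True (x i) (x (i - 1)) (y i) (x (i + 1)) (y i) \<longleftrightarrow>
      x (i - 1) * (x i - x (i + 1)) = y i * (x i - x (i - 1))"
    using d nz[of i] by (auto simp: divide_simps)
  then show "hyperbolicity_eq False True (z (upper N i)) (z (upper N (i - 1))) (z (lower N i))
      (z (upper N (i + 1))) (z (lower N i)) \<longleftrightarrow>
      z (upper N (i - 1)) * (z (upper N i) - z (upper N (i + 1))) =
      z (lower N i) * (z (upper N i) - z (upper N (i - 1)))"
    by (simp add: x_def y_def)
qed

end

section \<open>Solving the relations\<close>

text \<open>Over a common denominator each relation becomes a bilinear identity between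
  \<open>X\<close> and \<open>D\<close>, in which the recurrence makes the terms with
  \<open>s\<close> cancel.\<close>

lemma torus_relations_fib_ratio:
  assumes X: "fib_rec s X" and D: "fib_rec s D" and nz: "\<And>i. D i \<noteq> 0"
  shows "torus_relations (\<lambda>i. X i / D i) (\<lambda>i. X (i - 1) / D (i + 1))"
  unfolding torus_relations_def
proof (intro allI conjI)
  fix i
  have D1: "D (i + 1) = s * D i + D (i - 1)" and D2: "D (i + 2) = s * D (i + 1) + D i"
    and X0: "X i = s * X (i - 1) + X (i - 2)" and X1: "X (i + 1) = s * X i + X (i - 1)"
    using fib_recD[OF D, of i] fib_recD[OF D, of "i + 1"]
      fib_recD[OF X, of "i - 1"] fib_recD[OF X, of i] by (simp_all add: add_ac)
  have idx: "i + 1 + 1 = i + 2" "i - 1 - 1 = i - 2" "i - 1 + 1 = i" "i + 1 - 1 = i" by simp_all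
  have "X (i - 1) * D (i + 2) - X i * D (i + 1) = X (i - 1) * D i - X (i - 2) * D (i + 1)"
    unfolding D2 X0 by (simp add: algebra_simps)
  then have "X i * (X (i - 1) * D (i + 2) - X i * D (i + 1)) / (D i * D (i + 1) * D (i + 2)) =
      X i * (X (i - 1) * D i - X (i - 2) * D (i + 1)) / (D i * D (i + 1) * D (i + 2))"
    by simp
  then show "X i / D i * (X (i - 1) / D (i + 1) - X (i + 1 - 1) / D (i + 1 + 1)) =
      X (i + 1 - 1) / D (i + 1 + 1) * (X (i - 1) / D (i + 1) - X (i - 1 - 1) / D (i - 1 + 1))"
    unfolding idx using nz[of i] nz[of "i + 1"] nz[of "i + 2"] by (simp add: diff_frac_eq mult_ac)
  have "X i * D (i + 1) - X (i + 1) * D i = X i * D (i - 1) - X (i - 1) * D i"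
    unfolding D1 X1 by (simp add: algebra_simps)
  then have "X (i - 1) * (X i * D (i + 1) - X (i + 1) * D i) / (D (i - 1) * D i * D (i + 1)) =
      X (i - 1) * (X i * D (i - 1) - X (i - 1) * D i) / (D (i - 1) * D i * D (i + 1))"
    by simp
  then show "X (i - 1) / D (i - 1) * (X i / D i - X (i + 1) / D (i + 1)) =
      X (i - 1) / D (i + 1) * (X i / D i - X (i - 1) / D (i - 1))"
    using nz[of "i - 1"] nz[of i] nz[of "i + 1"] by (simp add: diff_frac_eq mult_ac)
qed

text \<open>Each relation is linear in its newest variable, \<open>y (i + 1)\<close> or
  \<open>x (i + 1)\<close>, and can be solved for it. That the next denominator does not vanish is
  part of the conclusion.\<close>

lemma torus_relations_step:
  assumes rel: "torus_relations x y" and nz: "\<And>i. x i \<noteq> 0" "\<And>i. y i \<noteq> 0"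
    and X: "fib_rec s X" and D: "fib_rec s D"
    and D0: "D (i - 1) \<noteq> 0" "D i \<noteq> 0" "D (i + 1) \<noteq> 0"
    and x: "x (i - 1) = X (i - 1) / D (i - 1)" "x i = X i / D i"
    and y: "y (i - 1) = X (i - 2) / D i" "y i = X (i - 1) / D (i + 1)"
  shows "D (i + 2) \<noteq> 0" "x (i + 1) = X (i + 1) / D (i + 1)" "y (i + 1) = X i / D (i + 2)"
proof -
  have D1: "D (i + 1) = s * D i + D (i - 1)" and D2: "D (i + 2) = s * D (i + 1) + D i"
    and X0: "X i = s * X (i - 1) + X (i - 2)" and X1: "X (i + 1) = s * X i + X (i - 1)"
    using fib_recD[OF D, of i] fib_recD[OF D, of "i + 1"]
      fib_recD[OF X, of "i - 1"] fib_recD[OF X, of i] by (simp_all add: add_ac)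
  have rel_y: "x i * (y i - y (i + 1)) = y (i + 1) * (y i - y (i - 1))"
    and rel_x: "x (i - 1) * (x i - x (i + 1)) = y i * (x i - x (i - 1))"
    using rel by (simp_all add: torus_relations_def)
  have X': "X (i - 1) \<noteq> 0" using nz(1)[of "i - 1"] x(1) by auto
  \<comment> \<open>This is the coefficient of \<open>y (i + 1)\<close>; its product with
    \<open>y (i + 1)\<close> is \<open>x i * y i\<close>, which is non-zero, so
    \<open>D (i + 2)\<close> cannot vanish.\<close>
  have "x i + y i - y (i - 1) = X (i - 1) * D (i + 2) / (D i * D (i + 1))"
    unfolding x y D2 X0 using D0 by (simp add: field_simps)
  moreover have "y (i + 1) * (x i + y i - y (i - 1)) = x i * y i"
    using rel_y by (simp add: algebra_simps)
  ultimately have eq: "y (i + 1) * (X (i - 1) * D (i + 2) / (D i * D (i + 1))) = x i * y i"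
    by simp
  with nz[of i] show D2': "D (i + 2) \<noteq> 0" by auto
  with eq show "y (i + 1) = X i / D (i + 2)"
    unfolding x y using D0 X' by (simp add: field_simps)
  have "x (i - 1) * x (i + 1) = x (i - 1) * x i - y i * (x i - x (i - 1))"
    using rel_x by (simp add: algebra_simps)
  then have "x (i + 1) = x i - y i * (x i - x (i - 1)) / x (i - 1)"
    using nz(1)[of "i - 1"] by (simp add: field_simps)
  also have "y i * (x i - x (i - 1)) / x (i - 1) =
      (X i * D (i - 1) - X (i - 1) * D i) / (D i * D (i + 1))"
    unfolding x y using D0 X' by (simp add: divide_simps)
  also have "x i - \<dots> = X (i + 1) / D (i + 1)"
  proof -
    have "X i * D (i + 1) - (X i * D (i - 1) - X (i - 1) * D i) = X (i + 1) * D i"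
      unfolding D1 X1 by (simp add: algebra_simps)
    then show ?thesis
      unfolding x using D0 by (simp add: divide_simps)
  qed
  finally show "x (i + 1) = X (i + 1) / D (i + 1)" .
qed

lemma torus_relations_imp_fib_ratio:
  assumes rel: "torus_relations x y" and nz: "\<And>i. x i \<noteq> 0" "\<And>i. y i \<noteq> 0"
    and X: "fib_rec s X" and D: "fib_rec s D"
    and D0: "D 1 \<noteq> 0" "D 2 \<noteq> 0" "D 3 \<noteq> 0"
    and x: "x 1 = X 1 / D 1" "x 2 = X 2 / D 2" and y: "y 1 = X 0 / D 2" "y 2 = X 1 / D 3"
    and i: "i \<ge> 1"
  shows "D i \<noteq> 0 \<and> D (i + 1) \<noteq> 0 \<and> x i = X i / D i \<and> y i = X (i - 1) / D (i + 1)"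
proof -
  let ?P = "\<lambda>i. D i \<noteq> 0 \<and> D (i + 1) \<noteq> 0 \<and> x i = X i / D i \<and> y i = X (i - 1) / D (i + 1)"
  have "?P i \<and> ?P (i + 1)"
    using i
  proof (induction i rule: int_ge_induct)
    case base
    show ?case using D0 x y by simp
  next
    case (step i)
    then show ?case
      using torus_relations_step[OF rel nz X D, of "i + 1"] by (simp add: add_ac)
  qed
  then show ?thesis ..
qed

text \<open>The equality \<open>x i = y (i + 1)\<close> would propagate in steps of two and give
  \<open>x (i + 2) = x i\<close>. As \<open>N + 1\<close> is even,
  \<open>x (i + 1 + N) = x i\<close>, whereas periodicity gives \<open>x (i + 1)\<close>.\<close>

lemma torus_relations_odd_period:
  assumes rel: "torus_relations x y" and nz: "\<And>i. x i \<noteq> 0" "\<And>i. y i \<noteq> 0"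
    and per: "\<And>i. x (i + int N) = x i" and "odd N" and ne: "x (i + 1) \<noteq> x i"
  shows "x i \<noteq> y (i + 1)"
proof
  assume eq: "x i = y (i + 1)"
  have x: "x (j + 2) = x j" and y: "x (j + 2) = y (j + 3)" if "x j = y (j + 1)" for j
  proof -
    have "x j * (x (j + 1) - x (j + 2)) = y (j + 1) * (x (j + 1) - x j)"
      using rel[unfolded torus_relations_def, rule_format, of "j + 1"] by (simp add: add.assoc)
    then show x: "x (j + 2) = x j"
      using that nz(2)[of "j + 1"] by simp
    have "x (j + 2) * (y (j + 2) - y (j + 3)) = y (j + 3) * (y (j + 2) - y (j + 1))"
      using rel[unfolded torus_relations_def, rule_format, of "j + 2"] by (simp add: add_ac)
    then have "y (j + 2) * x (j + 2) = y (j + 2) * y (j + 3)"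
      using x that by (simp add: algebra_simps)
    then show "x (j + 2) = y (j + 3)"
      using nz(2)[of "j + 2"] by simp
  qed
  have "x (i + 2 * int k) = x i \<and> x (i + 2 * int k) = y (i + 2 * int k + 1)" for k
  proof (induction k)
    case (Suc k)
    have "i + 2 * int (Suc k) = i + 2 * int k + 2" "i + 2 * int (Suc k) + 1 = i + 2 * int k + 3"
      by simp_all
    with Suc show ?case
      using x[of "i + 2 * int k"] y[of "i + 2 * int k"] by metis
  qed (use eq in simp)
  moreover obtain k where "N + 1 = 2 * k"
    using \<open>odd N\<close> by (metis even_plus_one_iff dvdE)
  ultimately have "x (i + 1 + int N) = x i"
    by (metis add.assoc add.commute of_nat_1 of_nat_add of_nat_mult of_nat_numeral)
  then show False using per ne by simp
qed

section \<open>Explicit formulas and the closing condition\<close>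

theorem theorem6p5:
  fixes N :: nat and z :: "nat \<Rightarrow> complex" and sqr :: "complex \<Rightarrow> complex"
  assumes "N \<ge> 3" and "odd N"
    and sqr: "\<And>\<Lambda>. sqr \<Lambda> ^ 2 = \<Lambda>"
    and nonzero: "\<forall>k\<in>{1..2 * N}. z k \<noteq> 0"
    and distinct: "corners_distinct (torus_diagram N) z"
  shows "boundary_parabolic_solution (torus_diagram N) z \<longleftrightarrow>
    (\<exists>p q r \<Lambda> :: complex.
      let s = sqr \<Lambda>; B = fibW s in
        B (int N) = 0 \<and>
        (\<forall>i\<in>{1..N}.
          (r - q) * B (int i - 2) + p * s * B (int i - 1) \<noteq> 0 \<and>
          (r - q) * B (int i - 1) + p * s * B (int i) \<noteq> 0 \<and>
          z (2 * i - 1) =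
            (p * q * s * B (int i - 1) + p * (r - q) * B (int i)) /
            ((r - q) * B (int i - 2) + p * s * B (int i - 1)) \<and>
          z (2 * i) =
            (p * q * s * B (int i - 2) + p * (r - q) * B (int i - 1)) /
            ((r - q) * B (int i - 1) + p * s * B (int i))))"
proof -
  have N: "N \<ge> 1" using \<open>N \<ge> 3\<close> by simp
  define x where "x = (\<lambda>i. z (upper N i))"
  define y where "y = (\<lambda>i. z (lower N i))"
  have nz: "x i \<noteq> 0" "y i \<noteq> 0" for i
    using nonzero segment_bounds[OF N] by (auto simp: x_def y_def)
  have x_period: "x (i + int N) = x i" for i by (simp add: x_def)
  have x_nat: "z (2 * i - 1) = x (int i)" and y_nat: "z (2 * i) = y (int i)"
    if "i \<in> {1..N}" for i
    using upper_of_nat[OF that] lower_of_nat[OF that] by (simp_all add: x_def y_def)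
  \<comment> \<open>Numerator and denominator of the odd-numbered variables; the even-numbered ones
    use the same sequences at \<open>i - 1\<close> and \<open>i + 1\<close>.\<close>
  define X where "X = (\<lambda>p q r s i. p * q * s * fibW s (i - 1) + p * (r - q) * fibW s i)"
  define D where "D = (\<lambda>p q r s i. (r - q) * fibW s (i - 2) + p * s * fibW s (i - 1))"
  have X_rec: "fib_rec s (X p q r s)" for p q r s
    using fib_rec_combination[OF fib_rec_fibW_shift[of s "-1"] fib_rec_fibW_shift[of s 0]]
    by (simp add: X_def)
  have D_rec: "fib_rec s (D p q r s)" for p q r s
    using fib_rec_combination[OF fib_rec_fibW_shift[of s "-2"] fib_rec_fibW_shift[of s "-1"]]
    by (simp add: D_def)
  have "boundary_parabolic_solution (torus_diagram N) z \<longleftrightarrow> torus_relations x y"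
    using hyperbolicity_eqs_torus_iff[OF N nonzero distinct] nonzero distinct
    by (simp add: boundary_parabolic_solution_def segments_torus_diagram[OF N] x_def y_def)
  also have "\<dots> \<longleftrightarrow> (\<exists>p q r \<Lambda>. fibW (sqr \<Lambda>) (int N) = 0 \<and>
      (\<forall>i\<in>{1..N}. D p q r (sqr \<Lambda>) (int i) \<noteq> 0 \<and> D p q r (sqr \<Lambda>) (int i + 1) \<noteq> 0 \<and>
        x (int i) = X p q r (sqr \<Lambda>) (int i) / D p q r (sqr \<Lambda>) (int i) \<and>
        y (int i) = X p q r (sqr \<Lambda>) (int i - 1) / D p q r (sqr \<Lambda>) (int i + 1)))"
    (is "_ \<longleftrightarrow> ?R")
  proof
    assume rel: "torus_relations x y"
    have x_ne: "x i \<noteq> x (i + 1)" for i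
      using distinct
      by (auto simp: corners_distinct_def torus_diagram_cyclic[OF N] cyclic_crossing_simps[OF N] x_def)
    note ne = torus_relations_odd_period[OF rel nz x_period \<open>odd N\<close> x_ne[symmetric]]
    define p where "p = x 1"
    define q where "q = y 1"
    define r where "r = x 2"
    \<comment> \<open>Obtained by solving \<open>y 2 = X 1 / D 3\<close> with
      \<open>X 1 = p * (r - q)\<close> and \<open>D 3 = r - q + p * \<Lambda>\<close>.\<close>
    define \<Lambda> where "\<Lambda> = (r - q) * (p - y 2) / (p * y 2)"
    define s where "s = sqr \<Lambda>"
    let ?X = "X p q r s" and ?D = "D p q r s"
    have pne: "p \<noteq> 0" using nz by (simp add: p_def)
    \<comment> \<open>With \<open>x 2 = y 1\<close> this relation would yield
      \<open>x 2 = y 3\<close>, which the odd period excludes.\<close>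
    have "x 2 * (y 2 - y 3) = y 3 * (y 2 - y 1)"
      using rel[unfolded torus_relations_def, rule_format, of 2] by simp
    then have "r \<noteq> q"
      using ne[of 2] nz(2)[of 2] by (auto simp: r_def q_def algebra_simps)
    moreover have "p \<noteq> y 2" using ne[of 1] by (simp add: p_def)
    ultimately have "\<Lambda> \<noteq> 0" using nz pne by (simp add: \<Lambda>_def)
    have s2: "s * s = \<Lambda>" using sqr[of \<Lambda>] by (simp add: s_def power2_eq_square)
    with \<open>\<Lambda> \<noteq> 0\<close> have "s \<noteq> 0" by auto
    have XD: "?X 0 = p * q * s" "?X 1 = p * (r - q)" "?X 2 = p * s * r"
      "?D 1 = r - q" "?D 2 = p * s"
      by (simp_all add: X_def D_def algebra_simps)
    have "?D 3 = r - q + p * \<Lambda>" by (simp add: D_def flip: s2)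
    also have "\<dots> = p * (r - q) / y 2"
      using nz(2)[of 2] pne by (simp add: \<Lambda>_def field_simps)
    finally have D3: "?D 3 = p * (r - q) / y 2" .
    have sol: "?D i \<noteq> 0 \<and> ?D (i + 1) \<noteq> 0 \<and> x i = ?X i / ?D i \<and> y i = ?X (i - 1) / ?D (i + 1)"
      if "i \<ge> 1" for i
      using that
    proof (rule torus_relations_imp_fib_ratio[OF rel nz X_rec D_rec, rotated -1])
      show "?D 1 \<noteq> 0" "?D 2 \<noteq> 0" "?D 3 \<noteq> 0"
        "x 1 = ?X 1 / ?D 1" "x 2 = ?X 2 / ?D 2" "y 1 = ?X 0 / ?D 2" "y 2 = ?X 1 / ?D 3"
        using \<open>r \<noteq> q\<close> \<open>s \<noteq> 0\<close> pne nz(2)[of 2] unfolding D3 XD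
        by (simp_all add: p_def q_def r_def)
    qed
    \<comment> \<open>This is \<open>x (1 + N) = x 1\<close> cross-multiplied. After the addition
      formula the terms with \<open>fibW s (N - 1)\<close> cancel, leaving \<open>fibW s N\<close>
      times a determinant of initial values.\<close>
    have "?X (1 + int N) * ?D 1 = ?X 1 * ?D (1 + int N)"
      using sol[of 1] sol[of "1 + int N"] x_period[of 1] by (simp add: field_simps)
    then have "fibW s (int N) * (?X 2 * ?D 1 - ?X 1 * ?D 2) = 0"
      using fib_rec_addition[OF X_rec, of p q r s 1 "int N"]
        fib_rec_addition[OF D_rec, of p q r s 1 "int N"] by (simp add: algebra_simps)
    moreover have "?X 2 * ?D 1 - ?X 1 * ?D 2 = p * s * (r - q) * (r - p)"
      unfolding XD by (simp add: algebra_simps)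
    moreover have "r \<noteq> p" using x_ne[of 1] by (simp add: r_def p_def)
    ultimately have "fibW s (int N) = 0"
      using pne \<open>s \<noteq> 0\<close> \<open>r \<noteq> q\<close> by simp
    then show ?R
      using sol unfolding s_def by (intro exI[of _ p] exI[of _ q] exI[of _ r] exI[of _ \<Lambda>]) auto
  next
    assume ?R
    then obtain p q r s where B: "fibW s (int N) = 0" and
      sol: "\<And>i. i \<in> {1..N} \<Longrightarrow> D p q r s (int i) \<noteq> 0 \<and>
        x (int i) = X p q r s (int i) / D p q r s (int i) \<and>
        y (int i) = X p q r s (int i - 1) / D p q r s (int i + 1)"
      by blast
    let ?X = "X p q r s" and ?D = "D p q r s"
    let ?P = "\<lambda>i. ?D i \<noteq> 0 \<and> x i = ?X i / ?D i \<and> y i = ?X (i - 1) / ?D (i + 1)"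
    \<comment> \<open>Shifting by \<open>N\<close> multiplies \<open>X\<close> and \<open>D\<close>
      by the same non-zero factor \<open>fibW s (N + 1)\<close>, so the formulas, given only for
      \<open>1, ..., N\<close>, extend to all integers.\<close>
    have period: "?P (i + int N) \<longleftrightarrow> ?P i" for i
      using fib_rec_shift_period[OF X_rec B, of p q r i]
        fib_rec_shift_period[OF X_rec B, of p q r "i - 1"]
        fib_rec_shift_period[OF D_rec B, of p q r i]
        fib_rec_shift_period[OF D_rec B, of p q r "i + 1"] fibW_Suc_nonzero[OF B]
      by (simp add: x_def y_def algebra_simps)
    have period': "?P (i + k * int N) \<longleftrightarrow> ?P i" for i k
    proof (induction k rule: int_induct[where k = 0])
      case (step1 k)
      then show ?case using period[of "i + k * int N"] by (simp add: algebra_simps)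
    next
      case (step2 k)
      then show ?case using period[of "i + (k - 1) * int N"] by (simp add: algebra_simps)
    qed simp
    have P: "?P i" for i
    proof -
      \<comment> \<open>The representative of \<open>i\<close> modulo \<open>N\<close> in
        \<open>{1..N}\<close>.\<close>
      define m where "m = nat ((i - 1) mod int N) + 1"
      have "(i - 1) mod int N < int N" "0 \<le> (i - 1) mod int N" using N by auto
      then have "m \<in> {1..N}" and m: "int m = (i - 1) mod int N + 1" by (auto simp: m_def)
      moreover have "int m + (i - 1) div int N * int N = i"
        unfolding m using div_mult_mod_eq[of "i - 1" "int N"] by simp
      ultimately show ?thesis
        using sol[of m] period'[of "int m" "(i - 1) div int N"] by metis
    qed
    then have "x = (\<lambda>i. ?X i / ?D i)" "y = (\<lambda>i. ?X (i - 1) / ?D (i + 1))" by auto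
    then show "torus_relations x y"
      using torus_relations_fib_ratio[OF X_rec D_rec, of p q r s p q r] P by auto
  qed
  also have "\<dots> \<longleftrightarrow> (\<exists>p q r \<Lambda> :: complex.
      let s = sqr \<Lambda>; B = fibW s in
        B (int N) = 0 \<and>
        (\<forall>i\<in>{1..N}.
          (r - q) * B (int i - 2) + p * s * B (int i - 1) \<noteq> 0 \<and>
          (r - q) * B (int i - 1) + p * s * B (int i) \<noteq> 0 \<and>
          z (2 * i - 1) =
            (p * q * s * B (int i - 1) + p * (r - q) * B (int i)) /
            ((r - q) * B (int i - 2) + p * s * B (int i - 1)) \<and>
          z (2 * i) =
            (p * q * s * B (int i - 2) + p * (r - q) * B (int i - 1)) /
            ((r - q) * B (int i - 1) + p * s * B (int i))))"
    by (simp add: Let_def X_def D_def x_nat y_nat del: One_nat_def)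
  finally show ?thesis .
qed

end
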